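(* Let $G$ and $H$ be vertex-disjoint connected graphs, let $u_1,\dots,u_k$ be pairwise distinct vertices of $G$ and $v_1,\dots,v_k$ pairwise distinct vertices of $H$. Suppose that $G_S$ and $H_S$ are $T$-equivalent for every subset $S$ of $\{\{i,j\}:1\le i<j\le k\}$. Then for an arbitrary graph $W$ (vertex-disjoint from $G$ and $H$) with pairwise distinct vertices $w_1,\dots,w_k$, the graphs $G(u_1,\dots,u_k)\sqcup W(w_1,\dots,w_k)$ and $H(v_1,\dots,v_k)\sqcup W(w_1,\dots,w_k)$ are $T$-equivalent.
   Context: Graphs may have loops and parallel edges. The Tutte polynomial of $G=(V,E)$ is $T_G(x,y)=\sum_{A\subseteq E}(x-1)^{r(E)-r(A)}(y-1)^{|A|-r(A)}$ with $r(A)=|V|-c(A)$, $c(A)$ the number of components of $(V,A)$. Two graphs are $T$-equivalent if they have the same Tutte polynomial. For $S\subseteq\{\{i,j\}:1\le i<j\le k\}$, $G_S$ is the graph obtained from $G$ by adding, for each $\{i,j\}\in S$, one new edge joining $u_i$ and $u_j$; $H_S$ is defined analogously using $v_i,v_j$. For vertex-disjoint graphs $G,W$ with $u_1,\dots,u_k\in V(G)$ and $w_1,\dots,w_k\in V(W)$, $G(u_1,\dots,u_k)\sqcup W(w_1,\dots,w_k)$ is the graph obtained from $G$ and $W$ by identifying $u_i$ and $w_i$ into a single vertex for every $i\in\{1,\dots,k\}$. *)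

theory Defs
  imports "HOL-Computational_Algebra.Polynomial"
begin

text \<open>Undirected graphs with loops and parallel edges: every edge has a set of one (loop) or
  two endpoints.\<close>

record ('v, 'e) mgraph =
  verts :: "'v set"
  edges :: "'e set"
  ends :: "'e \<Rightarrow> 'v set"

definition multigraph :: "('v, 'e) mgraph \<Rightarrow> bool" where
  "multigraph G \<longleftrightarrow> finite (verts G) \<and> finite (edges G) \<and>
     (\<forall>e \<in> edges G. ends G e \<subseteq> verts G \<and> card (ends G e) \<in> {1, 2})"

definition adjacent :: "('v, 'e) mgraph \<Rightarrow> 'v \<Rightarrow> 'v \<Rightarrow> bool" where
  "adjacent G x y \<longleftrightarrow> (\<exists>e \<in> edges G. ends G e = {x, y})"

definition joined :: "('v, 'e) mgraph \<Rightarrow> 'v \<Rightarrow> 'v \<Rightarrow> bool" where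
  "joined G = (adjacent G)\<^sup>*\<^sup>*"

definition connected_graph :: "('v, 'e) mgraph \<Rightarrow> bool" where
  "connected_graph G \<longleftrightarrow> verts G \<noteq> {} \<and> (\<forall>x \<in> verts G. \<forall>y \<in> verts G. joined G x y)"

definition graph_components :: "('v, 'e) mgraph \<Rightarrow> 'v set set" where
  "graph_components G = verts G // {(x, y). joined G x y}"

definition num_comps :: "('v, 'e) mgraph \<Rightarrow> 'e set \<Rightarrow> nat" where
  "num_comps G A = card (graph_components (G\<lparr>edges := A\<rparr>))"

definition graph_rank :: "('v, 'e) mgraph \<Rightarrow> 'e set \<Rightarrow> nat" where
  "graph_rank G A = card (verts G) - num_comps G A"

text \<open>Bivariate integer polynomials are polynomials in \<open>y\<close> over polynomials in \<open>x\<close>.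
  The truncated subtractions on \<^typ>\<open>nat\<close> in the rank and in the exponents are exact for
  every \<^const>\<open>multigraph\<close>.\<close>

definition var_x :: "int poly poly" where "var_x = [:[:0, 1:]:]"
definition var_y :: "int poly poly" where "var_y = [:0, 1:]"

definition tutte :: "('v, 'e) mgraph \<Rightarrow> int poly poly" where
  "tutte G = (\<Sum>A \<in> Pow (edges G).
     (var_x - 1) ^ (graph_rank G (edges G) - graph_rank G A) * (var_y - 1) ^ (card A - graph_rank G A))"

definition T_equivalent :: "('v, 'e) mgraph \<Rightarrow> ('w, 'f) mgraph \<Rightarrow> bool" where
  "T_equivalent G H \<longleftrightarrow> tutte G = tutte H"

definition index_pairs :: "nat \<Rightarrow> nat set set" where
  "index_pairs k = {{i, j} | i j. 1 \<le> i \<and> i < j \<and> j \<le> k}"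

text \<open>The graph \<open>G\<^sub>S\<close>: the new edge for \<open>{i, j} \<in> S\<close> is labelled \<open>Inr {i, j}\<close>, and its set of
  endpoints \<open>u ` {i, j}\<close> is \<open>{u i, u j}\<close>.\<close>

definition add_edges ::
  "('v, 'e) mgraph \<Rightarrow> (nat \<Rightarrow> 'v) \<Rightarrow> nat set set \<Rightarrow> ('v, 'e + nat set) mgraph" where
  "add_edges G u S =
     \<lparr>verts = verts G, edges = edges G <+> S, ends = case_sum (ends G) (\<lambda>s. u ` s)\<rparr>"

text \<open>Gluing is defined for graphs with disjoint vertex sets; a vertex of the result is a class
  of the equivalence relation generated by \<open>u i \<sim> w i\<close> for \<open>1 \<le> i \<le> k\<close>.\<close>

definition ident_rel :: "nat \<Rightarrow> (nat \<Rightarrow> 'v) \<Rightarrow> (nat \<Rightarrow> 'v) \<Rightarrow> ('v \<times> 'v) set" where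
  "ident_rel k u w = {(x, y). equivclp (\<lambda>a b. \<exists>i \<in> {1..k}. a = u i \<and> b = w i) x y}"

definition glue ::
  "nat \<Rightarrow> ('v, 'e) mgraph \<Rightarrow> (nat \<Rightarrow> 'v) \<Rightarrow> ('v, 'f) mgraph \<Rightarrow> (nat \<Rightarrow> 'v) \<Rightarrow>
   ('v set, 'e + 'f) mgraph" where
  "glue k G u W w =
     \<lparr>verts = (verts G \<union> verts W) // ident_rel k u w,
      edges = edges G <+> edges W,
      ends = (\<lambda>e. case_sum (ends G) (ends W) e // ident_rel k u w)\<rparr>"

end

theory Submission
  imports Defs
begin

text \<open>Write \<open>P = x - 1\<close>, \<open>Q = y - 1\<close>. Up to the factor \<open>P ^ c(E) Q ^ |V|\<close> the Tutte polynomial is the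
  subgraph sum of \<open>P ^ c(A) Q ^ (|A| + c(A))\<close>. For \<open>B \<subseteq> E(W)\<close> let \<open>S\<^sub>B\<close> be the set of
  index pairs whose terminals \<open>w\<^sub>i, w\<^sub>j\<close> are joined in \<open>(V(W), B)\<close>. The components of the glued graph
  with edges \<open>A \<union> B\<close> are the components of \<open>G\<close> with edges \<open>A \<union> S\<^sub>B\<close>, together with the components of
  \<open>(V(W), B)\<close> that contain no terminal. So the subgraph sum of the glued graph is a combination, with
  coefficients depending only on \<open>W\<close>, of the partial sums of \<open>G\<^sub>S\<close> over edge sets containing all of
  \<open>S\<close>; these are determined by the subgraph sums of the graphs \<open>G\<^sub>S\<close> through induction on \<open>S\<close>.\<close>

section \<open>Components\<close>

lemma adjacent_sym: "adjacent G x y \<Longrightarrow> adjacent G y x"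
  by (auto simp: adjacent_def insert_commute)

lemma joined_sym: "joined G x y \<Longrightarrow> joined G y x"
  unfolding joined_def
  by (metis adjacent_sym sympD sympI symp_rtranclp)

lemma joined_refl [simp]: "joined G x x"
  by (simp add: joined_def)

lemma joined_trans: "joined G x y \<Longrightarrow> joined G y z \<Longrightarrow> joined G x z"
  by (simp add: joined_def)

lemma adjacent_imp_joined: "adjacent G x y \<Longrightarrow> joined G x y"
  by (simp add: joined_def)

text \<open>Induction along a walk. This is the way to show that vertices are not joined: find some
  \<open>f\<close> that is constant along edges and separates them.\<close>

lemma joined_invariant:
  assumes "joined G x y" and "\<And>a b. adjacent G a b \<Longrightarrow> f a = f b"
  shows "f x = f y"
  using assms(1) unfolding joined_def
  by (induction rule: rtranclp_induct) (auto simp: assms(2))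

lemma joined_image:
  assumes "joined G x y" and "\<And>a b. adjacent G a b \<Longrightarrow> joined G' (h a) (h b)"
  shows "joined G' (h x) (h y)"
  using assms(1) unfolding joined_def[of G]
  by (induction rule: rtranclp_induct) (auto intro: joined_trans assms(2))

text \<open>As a function of the vertex, a component can be compared with other labellings of
  \<open>verts G\<close>; counting components becomes counting an image.\<close>

definition component_of :: "('v, 'e) mgraph \<Rightarrow> 'v \<Rightarrow> 'v set" where
  "component_of G x = {y. joined G x y}"

lemma component_of_eq_iff: "component_of G x = component_of G y \<longleftrightarrow> joined G x y"
  unfolding component_of_def by (auto intro: joined_trans joined_sym)

lemma graph_components_eq: "graph_components G = component_of G ` verts G"
  by (auto simp: graph_components_def component_of_def quotient_def)

section \<open>Counting images by comparing kernels\<close>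

lemma card_image_eq_of_same_kernel:
  assumes "\<And>x y. x \<in> V \<Longrightarrow> y \<in> V \<Longrightarrow> f x = f y \<longleftrightarrow> g x = g y"
  shows "card (f ` V) = card (g ` V)"
proof (rule bij_betw_same_card)
  show "bij_betw (\<lambda>z. g (inv_into V f z)) (f ` V) (g ` V)"
    unfolding bij_betw_def
  proof
    show "inj_on (\<lambda>z. g (inv_into V f z)) (f ` V)"
      by (rule inj_onI) (metis assms f_inv_into_f inv_into_into)
    have "g (inv_into V f (f x)) = g x" if "x \<in> V" for x
      using that by (metis assms f_inv_into_f imageI inv_into_into)
    then show "(\<lambda>z. g (inv_into V f z)) ` f ` V = g ` V"
      by (simp add: image_image)
  qed
qed

text \<open>The assignment of \<open>g x\<close> to \<open>f x\<close> is well defined on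
  \<open>f\<close> V\<open>and maps it onto\<close>g \<open>V\<close>.\<close>

lemma card_image_le_of_coarser_kernel:
  assumes "finite V" and "\<And>x y. x \<in> V \<Longrightarrow> y \<in> V \<Longrightarrow> f x = f y \<Longrightarrow> g x = g y"
  shows "card (g ` V) \<le> card (f ` V)"
proof (rule surj_card_le)
  show "finite (f ` V)" using assms(1) by simp
  show "g ` V \<subseteq> (\<lambda>z. g (inv_into V f z)) ` f ` V"
  proof
    fix z assume "z \<in> g ` V"
    then obtain x where x: "x \<in> V" "z = g x" by auto
    then have "g (inv_into V f (f x)) = g x"
      by (metis assms(2) f_inv_into_f imageI inv_into_into)
    then show "z \<in> (\<lambda>z. g (inv_into V f z)) ` f ` V" using x by force
  qed
qed

lemma num_comps_eq: "num_comps G A = card (component_of (G\<lparr>edges := A\<rparr>) ` verts G)"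
  by (simp add: num_comps_def graph_components_eq)

lemma adjacent_mono: "adjacent (G\<lparr>edges := A\<rparr>) x y \<Longrightarrow> A \<subseteq> B \<Longrightarrow> adjacent (G\<lparr>edges := B\<rparr>) x y"
  by (auto simp: adjacent_def)

lemma joined_mono: "joined (G\<lparr>edges := A\<rparr>) x y \<Longrightarrow> A \<subseteq> B \<Longrightarrow> joined (G\<lparr>edges := B\<rparr>) x y"
  by (rule joined_image[where h = "\<lambda>x. x"]) (auto intro: adjacent_imp_joined adjacent_mono)

lemma num_comps_le_card:
  assumes "finite (verts G)" shows "num_comps G A \<le> card (verts G)"
  using assms by (simp add: num_comps_eq card_image_le)

lemma num_comps_antimono:
  assumes "finite (verts G)" "A \<subseteq> B" shows "num_comps G B \<le> num_comps G A"
  unfolding num_comps_eq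
  by (rule card_image_le_of_coarser_kernel) (use assms in \<open>auto simp: component_of_eq_iff intro: joined_mono\<close>)

lemma joined_no_edges: "joined (G\<lparr>edges := {}\<rparr>) x y \<longleftrightarrow> x = y"
  using joined_invariant[where f = id and G = "G\<lparr>edges := {}\<rparr>"] by (auto simp: adjacent_def)

lemma num_comps_no_edges: "num_comps G {} = card (verts G)"
  unfolding num_comps_eq
  by (rule card_image) (auto simp: inj_on_def component_of_eq_iff joined_no_edges)

text \<open>A new edge can only merge the component of \<open>a\<close> with that of
  \<open>b\<close>, so at most one component is lost.\<close>

lemma num_comps_insert_edge:
  assumes fin: "finite (verts G)" and e: "ends G e = {a, b}"
  shows "num_comps G A \<le> Suc (num_comps G (insert e A))"
proof -
  let ?c = "component_of (G\<lparr>edges := A\<rparr>)" and ?c' = "component_of (G\<lparr>edges := insert e A\<rparr>)"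
  \<comment> \<open>Relabelling the component of \<open>b\<close> as that of \<open>a\<close> makes
    the labels constant along \<open>e\<close> as well. Only the value \<open>?c b\<close> can
    disappear, and the labels never distinguish vertices joined after inserting
    \<open>e\<close>.\<close>
  define f where "f x = (if ?c x = ?c b then ?c a else ?c x)" for x
  have "f x = f y" if "adjacent (G\<lparr>edges := insert e A\<rparr>) x y" for x y
  proof -
    have "{x, y} = {a, b} \<or> adjacent (G\<lparr>edges := A\<rparr>) x y"
      using that e by (auto simp: adjacent_def)
    then show ?thesis
    proof
      assume "{x, y} = {a, b}"
      then show ?thesis by (auto simp: f_def doubleton_eq_iff)
    next
      assume "adjacent (G\<lparr>edges := A\<rparr>) x y"
      then have "?c x = ?c y" by (simp add: component_of_eq_iff adjacent_imp_joined)
      then show ?thesis by (simp add: f_def)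
    qed
  qed
  then have "card (f ` verts G) \<le> card (?c' ` verts G)"
    using joined_invariant[of "G\<lparr>edges := insert e A\<rparr>" _ _ f]
    by (intro card_image_le_of_coarser_kernel fin) (simp add: component_of_eq_iff)
  moreover have "?c ` verts G \<subseteq> insert (?c b) (f ` verts G)"
    by (auto simp: f_def image_iff)
  then have "card (?c ` verts G) \<le> card (insert (?c b) (f ` verts G))"
    using fin by (intro card_mono) auto
  moreover have "card (insert (?c b) (f ` verts G)) \<le> Suc (card (f ` verts G))"
    by (rule card_insert_le_m1) auto
  ultimately show ?thesis unfolding num_comps_eq by linarith
qed

lemma multigraph_ends_cases:
  assumes "multigraph G" "e \<in> edges G"
  obtains a b where "ends G e = {a, b}" "a \<in> verts G" "b \<in> verts G"
proof -
  have "card (ends G e) = 1 \<or> card (ends G e) = 2" and "ends G e \<subseteq> verts G"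
    using assms by (auto simp: multigraph_def)
  then show thesis using that by (force simp: card_1_singleton_iff card_2_iff)
qed

text \<open>Without edges every vertex is its own component, and each edge lowers the count by at
  most one. This makes the subtraction \<open>card A - graph_rank G A\<close> exact.\<close>

lemma card_verts_le_edges_plus_comps:
  assumes "multigraph G" "A \<subseteq> edges G"
  shows "card (verts G) \<le> card A + num_comps G A"
proof -
  have "finite A" using assms by (auto simp: multigraph_def intro: finite_subset)
  then show ?thesis using assms(2)
  proof (induction A)
    case empty
    show ?case by (simp add: num_comps_no_edges)
  next
    case (insert e A)
    from insert.prems obtain a b where "ends G e = {a, b}"
      by (meson assms(1) insertI1 multigraph_ends_cases subsetD)
    then have "num_comps G A \<le> Suc (num_comps G (insert e A))"
      using assms(1) num_comps_insert_edge by (auto simp: multigraph_def)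
    with insert show ?case by simp
  qed
qed

section \<open>The subgraph sum\<close>

text \<open>With \<open>c\<close> components and \<open>m\<close> edges this is
  \<open>q ^ c * t ^ m\<close> for \<open>q = (x - 1) * (y - 1)\<close> and
  \<open>t = y - 1\<close>, so that \<open>subgraph_sum\<close> is the Fortuin-Kasteleyn form of the
  Potts partition function. The weight is multiplicative in the pair \<open>(c, m)\<close>.\<close>

definition subgraph_weight :: "nat \<Rightarrow> nat \<Rightarrow> int poly poly" where
  "subgraph_weight c m = (var_x - 1) ^ c * (var_y - 1) ^ (m + c)"

definition subgraph_sum :: "('v, 'e) mgraph \<Rightarrow> int poly poly" where
  "subgraph_sum G = (\<Sum>A \<in> Pow (edges G). subgraph_weight (num_comps G A) (card A))"

lemma var_x_minus_1_nonzero: "var_x - 1 \<noteq> 0"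
  by (simp add: var_x_def one_pCons)

lemma var_y_minus_1_nonzero: "var_y - 1 \<noteq> 0"
  by (simp add: var_y_def one_pCons)

text \<open>In terms of components the exponents are \<open>c(A) - c(E)\<close> and
  \<open>|A| + c(A) - |V|\<close>; the prefactor removes both subtractions.\<close>

lemma tutte_subgraph_sum:
  assumes "multigraph G"
  shows "(var_x - 1) ^ num_comps G (edges G) * (var_y - 1) ^ card (verts G) * tutte G = subgraph_sum G"
proof -
  let ?c = "num_comps G" and ?n = "card (verts G)" and ?E = "edges G"
  have fin: "finite (verts G)" using assms by (simp add: multigraph_def)
  have "(var_x - 1) ^ ?c ?E * (var_y - 1) ^ ?n *
          ((var_x - 1) ^ (graph_rank G ?E - graph_rank G A) * (var_y - 1) ^ (card A - graph_rank G A))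
        = subgraph_weight (?c A) (card A)" if "A \<in> Pow ?E" for A
  proof -
    have "?c ?E + (graph_rank G ?E - graph_rank G A) = ?c A"
      using num_comps_antimono[OF fin, of A ?E] num_comps_le_card[OF fin, of A] that
      by (simp add: graph_rank_def)
    moreover have "?n + (card A - graph_rank G A) = card A + ?c A"
      using card_verts_le_edges_plus_comps[OF assms, of A] num_comps_le_card[OF fin, of A] that
      by (simp add: graph_rank_def)
    ultimately have "subgraph_weight (?c A) (card A) =
        (var_x - 1) ^ (?c ?E + (graph_rank G ?E - graph_rank G A)) *
        (var_y - 1) ^ (?n + (card A - graph_rank G A))"
      by (simp only: subgraph_weight_def)
    then show ?thesis by (simp only: power_add mult_ac)
  qed
  then show ?thesis
    unfolding tutte_def subgraph_sum_def sum_distrib_left by (intro sum.cong refl) simp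
qed

lemma sum_Pow_Plus:
  "(\<Sum>C \<in> Pow (E <+> F). h C) = (\<Sum>B \<in> Pow F. \<Sum>A \<in> Pow E. h (A <+> B))"
proof -
  have "bij_betw (\<lambda>(B, A). A <+> B) (Pow F \<times> Pow E) (Pow (E <+> F))"
    unfolding bij_betw_def
  proof
    show "inj_on (\<lambda>(B, A). A <+> B) (Pow F \<times> Pow E)"
      by (auto simp: inj_on_def Plus_def set_eq_iff)
    have "C \<in> (\<lambda>(B, A). A <+> B) ` (Pow F \<times> Pow E)" if "C \<subseteq> E <+> F" for C
    proof
      show "C = (\<lambda>(B, A). A <+> B) (Inr -` C, Inl -` C)"
        by (auto simp: Plus_def image_iff) (metis sumE)
      show "(Inr -` C, Inl -` C) \<in> Pow F \<times> Pow E" using that by auto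
    qed
    then show "(\<lambda>(B, A). A <+> B) ` (Pow F \<times> Pow E) = Pow (E <+> F)" by auto
  qed
  then have "(\<Sum>C \<in> Pow (E <+> F). h C) = (\<Sum>(B, A) \<in> Pow F \<times> Pow E. h (A <+> B))"
    by (subst sum.reindex_bij_betw[symmetric]) (auto simp: case_prod_unfold)
  then show ?thesis by (simp add: sum.cartesian_product)
qed

text \<open>All edges of \<open>S\<close> are present and affect the components, but
  \<open>card A\<close> does not count them: they record connections between terminals and carry no
  weight of their own.\<close>

definition subgraph_sum_with ::
  "('v, 'e) mgraph \<Rightarrow> (nat \<Rightarrow> 'v) \<Rightarrow> nat set set \<Rightarrow> int poly poly" where
  "subgraph_sum_with G u S =
     (\<Sum>A \<in> Pow (edges G). subgraph_weight (num_comps (add_edges G u S) (A <+> S)) (card A))"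

text \<open>\<open>num_comps\<close> overwrites the edge set, the only field of
  \<open>add_edges G u S\<close> that depends on \<open>S\<close>.\<close>

lemma num_comps_add_edges:
  "num_comps (add_edges G u S) C = num_comps (add_edges G u S') C"
  by (simp add: num_comps_def add_edges_def)

text \<open>Edge sets are sorted by the set \<open>S'\<close> of added edges they contain, each of
  which contributes one factor \<open>y - 1\<close>. The resulting system is triangular with respect
  to inclusion.\<close>

lemma subgraph_sum_add_edges:
  assumes "finite (edges G)" "finite S"
  shows "subgraph_sum (add_edges G u S) =
    (\<Sum>S' \<in> Pow S. (var_y - 1) ^ card S' * subgraph_sum_with G u S')"
proof -
  have "subgraph_weight (num_comps (add_edges G u S) (A <+> S')) (card (A <+> S')) =
     (var_y - 1) ^ card S' * subgraph_weight (num_comps (add_edges G u S') (A <+> S')) (card A)"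
    if "A \<in> Pow (edges G)" "S' \<in> Pow S" for A S'
  proof -
    have "card (A <+> S') = card A + card S'"
      using that assms by (intro card_Plus) (auto intro: finite_subset)
    then show ?thesis
      by (simp add: subgraph_weight_def power_add algebra_simps num_comps_add_edges[of G u S _ S'])
  qed
  moreover have "edges (add_edges G u S) = edges G <+> S" by (simp add: add_edges_def)
  ultimately show ?thesis
    unfolding subgraph_sum_def subgraph_sum_with_def sum_distrib_left by (simp add: sum_Pow_Plus)
qed

section \<open>Gluing\<close>

text \<open>These pairs encode the partition of the terminals induced by \<open>B\<close>, as a
  disjoint union of complete graphs on its blocks.\<close>

definition linked_pairs :: "nat \<Rightarrow> ('v, 'g) mgraph \<Rightarrow> (nat \<Rightarrow> 'v) \<Rightarrow> 'g set \<Rightarrow> nat set set" where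
  "linked_pairs k W w B =
     {{i, j} | i j. 1 \<le> i \<and> i < j \<and> j \<le> k \<and> joined (W\<lparr>edges := B\<rparr>) (w i) (w j)}"

definition free_verts :: "nat \<Rightarrow> ('v, 'g) mgraph \<Rightarrow> (nat \<Rightarrow> 'v) \<Rightarrow> 'g set \<Rightarrow> 'v set" where
  "free_verts k W w B = {x \<in> verts W. \<forall>i \<in> {1..k}. \<not> joined (W\<lparr>edges := B\<rparr>) x (w i)}"

definition free_comps :: "nat \<Rightarrow> ('v, 'g) mgraph \<Rightarrow> (nat \<Rightarrow> 'v) \<Rightarrow> 'g set \<Rightarrow> nat" where
  "free_comps k W w B = card (component_of (W\<lparr>edges := B\<rparr>) ` free_verts k W w B)"

lemma linked_pairs_subset: "linked_pairs k W w B \<subseteq> index_pairs k"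
  by (auto simp: linked_pairs_def index_pairs_def)

lemma linked_pairs_no_edges: "inj_on w {1..k} \<Longrightarrow> linked_pairs k W w {} = {}"
  unfolding linked_pairs_def joined_no_edges
  by (auto simp: inj_on_eq_iff)

lemma finite_index_pairs: "finite (index_pairs k)"
  by (rule finite_subset[of _ "Pow {1..k}"]) (auto simp: index_pairs_def)

section \<open>Added edges and gluing yield multigraphs\<close>

lemma multigraph_add_edges:
  assumes "multigraph G" "u ` {1..k} \<subseteq> verts G" "S \<subseteq> index_pairs k"
  shows "multigraph (add_edges G u S)"
proof -
  have "finite S" using assms(3) finite_index_pairs finite_subset by blast
  moreover have "u ` s \<subseteq> verts G \<and> card (u ` s) \<in> {1, 2}" if s_in: "s \<in> S" for s
  proof -
    obtain i j where s: "s = {i, j}" and "1 \<le> i" "i < j" "j \<le> k"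
      using s_in assms(3) unfolding index_pairs_def by blast
    then have "u i \<in> verts G" "u j \<in> verts G" using assms(2) by auto
    then show ?thesis by (simp add: s card_insert_if)
  qed
  then have "\<forall>s \<in> S. u ` s \<subseteq> verts G \<and> card (u ` s) \<in> {1, 2}" by blast
  ultimately show ?thesis
    using assms(1) unfolding multigraph_def add_edges_def Plus_def by (simp add: ball_Un)
qed

lemma quotient_doubleton: "{a, b} // r = {r `` {a}, r `` {b}}"
  by (auto simp: quotient_def)

lemma multigraph_glue:
  assumes G: "multigraph G" and W: "multigraph W"
  shows "multigraph (glue k G u W w)"
proof -
  let ?r = "ident_rel k u w" and ?V = "verts G \<union> verts W"
  have "case_sum (ends G) (ends W) e // ?r \<subseteq> ?V // ?r \<and>
      card (case_sum (ends G) (ends W) e // ?r) \<in> {1, 2}" if "e \<in> edges G <+> edges W" for e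
  proof -
    have "\<exists>a \<in> ?V. \<exists>b \<in> ?V. case_sum (ends G) (ends W) e = {a, b}"
      using that
    proof (elim PlusE)
      fix e' assume "e' \<in> edges G" "e = Inl e'"
      then show ?thesis by (auto intro: multigraph_ends_cases[OF G, of e'])
    next
      fix e' assume "e' \<in> edges W" "e = Inr e'"
      then show ?thesis by (auto intro: multigraph_ends_cases[OF W, of e'])
    qed
    then obtain a b where "a \<in> ?V" "b \<in> ?V" "case_sum (ends G) (ends W) e = {a, b}" by blast
    then show ?thesis
      by (simp add: quotient_doubleton quotientI card_insert_if)
  qed
  moreover have "finite (?V // ?r)"
    using G W by (auto simp: multigraph_def quotient_def)
  ultimately show ?thesis
    using G W unfolding multigraph_def by (simp add: glue_def)
qed

text \<open>Seen from \<open>G\<close>, the edges \<open>B\<close> matter only through the terminals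
  they join, and the edges of \<open>S\<close> join exactly those. The proof labels the vertices
  before identification by a function \<open>f\<close> with the same kernel as being joined after
  gluing, and then counts its image.\<close>

lemma num_comps_glue:
  fixes G :: "('v, 'e) mgraph" and W :: "('v, 'g) mgraph"
  assumes G: "multigraph G" and W: "multigraph W" and disj: "verts W \<inter> verts G = {}"
    and u: "u ` {1..k} \<subseteq> verts G" and w: "w ` {1..k} \<subseteq> verts W"
    and A: "A \<subseteq> edges G" and B: "B \<subseteq> edges W"
  defines "S \<equiv> linked_pairs k W w B"
  shows "num_comps (glue k G u W w) (A <+> B) =
           num_comps (add_edges G u S) (A <+> S) + free_comps k W w B"
proof -
  define GS where "GS = (add_edges G u S)\<lparr>edges := A <+> S\<rparr>"
  define WB where "WB = W\<lparr>edges := B\<rparr>"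
  define K where "K = (glue k G u W w)\<lparr>edges := A <+> B\<rparr>"
  define cls where "cls x = ident_rel k u w `` {x}" for x
  define V where "V = verts G \<union> verts W"
  define attached where "attached x i \<longleftrightarrow> i \<in> {1..k} \<and> joined WB x (w i)" for x i
  \<comment> \<open>A complete invariant of the components of the glued graph, on representatives.\<close>
  define f :: "'v \<Rightarrow> 'v set + 'v set" where
    "f x = (if x \<notin> verts W then Inl (component_of GS x)
            else if \<exists>i. attached x i then Inl (component_of GS (u (SOME i. attached x i)))
            else Inr (component_of WB x))" for x
  have u_in: "u i \<in> verts G" "u i \<notin> verts W" if "i \<in> {1..k}" for i
    using that u disj by blast+
  have w_in: "w i \<in> verts W" if "i \<in> {1..k}" for i
    using that w by blast
  \<comment> \<open>\<open>S\<close> lists a pair with the smaller index first, hence the case split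
    on the order of \<open>i\<close> and \<open>j\<close>.\<close>
  have S_joined: "joined GS (u i) (u j)"
    if ij: "i \<in> {1..k}" "j \<in> {1..k}" "joined WB (w i) (w j)" for i j
  proof (cases "i = j")
    case False
    have "{i, j} \<in> S"
    proof (cases "i < j")
      case True
      then show ?thesis using ij unfolding S_def linked_pairs_def WB_def by auto
    next
      case False
      with \<open>i \<noteq> j\<close> have "j < i" by simp
      then have "{j, i} \<in> S"
        using ij joined_sym[OF ij(3)] unfolding S_def linked_pairs_def WB_def by auto
      then show ?thesis by (simp add: insert_commute)
    qed
    then have "adjacent GS (u i) (u j)"
      unfolding adjacent_def GS_def add_edges_def by (intro bexI[of _ "Inr {i, j}"]) auto
    then show ?thesis by (rule adjacent_imp_joined)
  qed simp
  \<comment> \<open>The terminal picked by \<open>SOME\<close> does not matter: all terminals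
    attached to \<open>x\<close> are joined in \<open>WB\<close>, so their partners are joined in
    \<open>GS\<close>.\<close>
  have f_attached: "f x = Inl (component_of GS (u i))" if "x \<in> verts W" "attached x i" for x i
  proof -
    have "attached x (SOME i. attached x i)" using that(2) by (rule someI)
    then have "joined GS (u (SOME i. attached x i)) (u i)"
      using that(2) unfolding attached_def by (meson S_joined joined_sym joined_trans)
    then show ?thesis using that by (auto simp: f_def component_of_eq_iff)
  qed
  have f_u: "f (u i) = Inl (component_of GS (u i))" if "i \<in> {1..k}" for i
    using u_in[OF that] by (simp add: f_def)
  have f_w: "f (w i) = Inl (component_of GS (u i))" if "i \<in> {1..k}" for i
    using that w_in by (intro f_attached) (auto simp: attached_def)
  have f_ident: "f x = f y" if "(x, y) \<in> ident_rel k u w" for x y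
  proof -
    have "equivclp (\<lambda>a b. \<exists>i \<in> {1..k}. a = u i \<and> b = w i) x y"
      using that by (simp add: ident_rel_def)
    then show ?thesis
      by (induction rule: equivclp_induct) (auto simp: f_u f_w)
  qed
  have cls_eq_iff: "cls x = cls y \<longleftrightarrow> (x, y) \<in> ident_rel k u w" for x y
    unfolding cls_def ident_rel_def
    by (auto intro: equivclp_trans equivclp_sym)
  have cls_u_w: "cls (u i) = cls (w i)" if "i \<in> {1..k}" for i
    unfolding cls_eq_iff using that by (auto simp: ident_rel_def intro!: r_into_equivclp)
  have f_W: "f x = f y" if "x \<in> verts W" "y \<in> verts W" "joined WB x y" for x y
  proof (cases "\<exists>i. attached x i")
    case True
    then obtain i where i: "attached x i" by blast
    then have "attached y i" using that(3) unfolding attached_def by (meson joined_sym joined_trans)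
    then show ?thesis using i that f_attached by simp
  next
    case False
    then have "\<not> (\<exists>i. attached y i)" using that(3) unfolding attached_def by (meson joined_trans)
    then show ?thesis using False that by (simp add: f_def component_of_eq_iff)
  qed
  \<comment> \<open>Vertices of \<open>K\<close> are classes, on which \<open>f\<close> is not
    directly defined; the ends of the original edge in \<open>G\<close> or \<open>W\<close> supply
    representatives on which \<open>f\<close> agrees.\<close>
  have K_edge: "\<exists>a b. X = cls a \<and> Y = cls b \<and> f a = f b" if adj: "adjacent K X Y" for X Y
  proof -
    obtain e where e: "e \<in> A <+> B" "case_sum (ends G) (ends W) e // ident_rel k u w = {X, Y}"
      using adj by (auto simp: adjacent_def K_def glue_def)
    have "\<exists>a b. case_sum (ends G) (ends W) e = {a, b} \<and> f a = f b"
    proof (cases e)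
      case (Inl e')
      then have "e' \<in> A" using e by auto
      then obtain a b where ab: "ends G e' = {a, b}" "a \<in> verts G" "b \<in> verts G"
        using multigraph_ends_cases[OF G] A by blast
      then have "adjacent GS a b"
        using \<open>e' \<in> A\<close> unfolding adjacent_def GS_def add_edges_def
        by (intro bexI[of _ "Inl e'"]) auto
      then have "f a = f b"
        using ab disj by (auto simp: f_def component_of_eq_iff adjacent_imp_joined)
      then show ?thesis using ab Inl by auto
    next
      case (Inr e')
      then have "e' \<in> B" using e by auto
      then obtain a b where ab: "ends W e' = {a, b}" "a \<in> verts W" "b \<in> verts W"
        using multigraph_ends_cases[OF W] B by blast
      then have "adjacent WB a b"
        using \<open>e' \<in> B\<close> unfolding adjacent_def WB_def by auto
      then have "f a = f b" using ab f_W adjacent_imp_joined by metis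
      then show ?thesis using ab Inr by auto
    qed
    then obtain a b where "case_sum (ends G) (ends W) e = {a, b}" "f a = f b" by blast
    then have "{cls a, cls b} = {X, Y}" "f a = f b"
      using e(2) by (auto simp: quotient_doubleton cls_def)
    then show ?thesis by (metis doubleton_eq_iff)
  qed
  \<comment> \<open>Along a walk in \<open>K\<close> the representative may change at each vertex;
    \<open>f_ident\<close> ensures that \<open>f\<close> does not notice.\<close>
  have K_imp_f: "f x = f y" if "joined K (cls x) (cls y)" for x y
  proof -
    have "\<exists>b. Y = cls b \<and> f b = f x" if "joined K (cls x) Y" for Y
      using that unfolding joined_def
    proof (induction rule: rtranclp_induct)
      case base
      show ?case by blast
    next
      case (step Y Z)
      then obtain a b c where "Y = cls b" "f b = f x" "Y = cls a" "Z = cls c" "f a = f c"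
        using K_edge by metis
      then show ?case using cls_eq_iff f_ident by metis
    qed
    then show ?thesis using that cls_eq_iff f_ident by metis
  qed
  have WB_imp_K: "joined K (cls x) (cls y)" if "joined WB x y" for x y
    using that
  proof (rule joined_image)
    fix a b assume "adjacent WB a b"
    then obtain e where "e \<in> B" "ends W e = {a, b}" by (auto simp: adjacent_def WB_def)
    then have "adjacent K (cls a) (cls b)"
      unfolding adjacent_def K_def glue_def cls_def
      by (intro bexI[of _ "Inr e"]) (auto simp: quotient_doubleton)
    then show "joined K (cls a) (cls b)" by (rule adjacent_imp_joined)
  qed
  have GS_imp_K: "joined K (cls x) (cls y)" if "joined GS x y" for x y
    using that
  proof (rule joined_image)
    fix a b assume "adjacent GS a b"
    then obtain e where e: "e \<in> A <+> S" "case_sum (ends G) (\<lambda>s. u ` s) e = {a, b}"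
      by (auto simp: adjacent_def GS_def add_edges_def)
    show "joined K (cls a) (cls b)"
    proof (cases e)
      case (Inl e')
      then have "adjacent K (cls a) (cls b)"
        using e unfolding adjacent_def K_def glue_def cls_def
        by (intro bexI[of _ "Inl e'"]) (auto simp: quotient_doubleton)
      then show ?thesis by (rule adjacent_imp_joined)
    next
      case (Inr s)
      \<comment> \<open>An added edge is replaced by a walk through \<open>WB\<close> from
        \<open>w i\<close> to \<open>w j\<close>, whose ends are identified with \<open>u i\<close>
        and \<open>u j\<close>.\<close>
      then have "s \<in> S" "u ` s = {a, b}" using e by auto
      then obtain i j where "s = {i, j}" "1 \<le> i" "i < j" "j \<le> k" "joined WB (w i) (w j)"
        unfolding S_def linked_pairs_def WB_def by blast
      with \<open>u ` s = {a, b}\<close>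
      have ij: "i \<in> {1..k}" "j \<in> {1..k}" "joined WB (w i) (w j)" "{u i, u j} = {a, b}" by auto
      then have "joined K (cls (u i)) (cls (u j))"
        using WB_imp_K cls_u_w by metis
      then show ?thesis using ij(4) joined_sym by (metis doubleton_eq_iff)
    qed
  qed
  \<comment> \<open>Each vertex that is not free can be moved within \<open>K\<close> to a vertex of
    \<open>G\<close> with the same label, which reduces the converse \<open>f_imp_K\<close> to
    \<open>GS_imp_K\<close>.\<close>
  have left: "\<exists>x' \<in> verts G. joined K (cls x) (cls x') \<and> f x = Inl (component_of GS x')"
    if "x \<in> V" "x \<notin> free_verts k W w B" for x
  proof (cases "x \<in> verts W")
    case True
    with that(2) obtain i where i: "attached x i"
      by (auto simp: free_verts_def attached_def WB_def)
    then have "joined K (cls x) (cls (u i))"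
      unfolding attached_def using WB_imp_K cls_u_w by metis
    then show ?thesis using f_attached[OF True i] i u_in by (auto simp: attached_def)
  next
    case False
    then have "x \<in> verts G" "f x = Inl (component_of GS x)"
      using that by (auto simp: V_def f_def)
    then show ?thesis by (intro bexI[of _ x]) auto
  qed
  have right: "f x = Inr (component_of WB x)" if "x \<in> free_verts k W w B" for x
    using that by (auto simp: free_verts_def f_def attached_def WB_def)
  \<comment> \<open>The tags \<open>Inl\<close> and \<open>Inr\<close> prevent a free vertex from
    sharing a label with any other kind of vertex.\<close>
  have f_imp_K: "joined K (cls x) (cls y)" if "x \<in> V" "y \<in> V" "f x = f y" for x y
  proof (cases "x \<in> free_verts k W w B")
    case True
    have "y \<in> free_verts k W w B"
      using left[of y] right[OF True] that by auto
    then show ?thesis using True right that(3) by (auto simp: component_of_eq_iff intro: WB_imp_K)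
  next
    case False
    have "y \<notin> free_verts k W w B"
      using left[OF that(1) False] right[of y] that by auto
    with left[OF that(1) False] left[OF that(2)]
    obtain x' y' where *: "joined K (cls x) (cls x')" "f x = Inl (component_of GS x')"
      "joined K (cls y) (cls y')" "f y = Inl (component_of GS y')"
      by blast
    then have "joined K (cls x') (cls y')"
      using that(3) by (intro GS_imp_K) (simp add: component_of_eq_iff joined_sym)
    then show ?thesis using * by (meson joined_sym joined_trans)
  qed
  have "verts (glue k G u W w) = cls ` V"
    by (auto simp: glue_def V_def cls_def quotient_def)
  then have "num_comps (glue k G u W w) (A <+> B) = card (component_of K ` cls ` V)"
    by (simp only: num_comps_eq K_def)
  also have "\<dots> = card ((\<lambda>x. component_of K (cls x)) ` V)" by (simp add: image_image)
  also have "\<dots> = card (f ` V)"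
    by (rule card_image_eq_of_same_kernel, unfold component_of_eq_iff) (blast intro: K_imp_f f_imp_K)
  also have "f ` V = Inl ` component_of GS ` verts G \<union> Inr ` component_of WB ` free_verts k W w B"
    (is "_ = ?R")
  proof
    show "f ` V \<subseteq> ?R"
    proof
      fix z assume "z \<in> f ` V"
      then obtain x where "x \<in> V" "z = f x" by blast
      then show "z \<in> ?R" using left[of x] right[of x] by (cases "x \<in> free_verts k W w B") auto
    qed
    have "Inl (component_of GS x) \<in> f ` V" if "x \<in> verts G" for x
    proof
      show "Inl (component_of GS x) = f x" using that disj by (auto simp: f_def)
    qed (use that in \<open>simp add: V_def\<close>)
    moreover have "Inr (component_of WB x) \<in> f ` V" if "x \<in> free_verts k W w B" for x
    proof
      show "Inr (component_of WB x) = f x" using right[OF that] by simp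
    qed (use that in \<open>simp add: V_def free_verts_def\<close>)
    ultimately show "?R \<subseteq> f ` V" by auto
  qed
  also have "card \<dots> = card (component_of GS ` verts G <+> component_of WB ` free_verts k W w B)"
    by (simp add: Plus_def)
  also have "\<dots> = card (component_of GS ` verts G) + card (component_of WB ` free_verts k W w B)"
    using G W by (intro card_Plus) (auto simp: multigraph_def free_verts_def)
  finally show ?thesis
    by (simp add: num_comps_eq free_comps_def GS_def WB_def add_edges_def)
qed

text \<open>By multiplicativity of the weight, the count from \<open>num_comps_glue\<close> splits
  each term into a factor determined by \<open>W\<close> and \<open>B\<close> and a term of
  \<open>subgraph_sum_with\<close>.\<close>

lemma subgraph_sum_glue:
  assumes "multigraph G" "multigraph W" "verts W \<inter> verts G = {}"
    and "u ` {1..k} \<subseteq> verts G" "w ` {1..k} \<subseteq> verts W"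
  shows "subgraph_sum (glue k G u W w) =
    (\<Sum>B \<in> Pow (edges W). subgraph_weight (free_comps k W w B) (card B) *
       subgraph_sum_with G u (linked_pairs k W w B))"
proof -
  let ?S = "linked_pairs k W w"
  have "subgraph_weight (num_comps (glue k G u W w) (A <+> B)) (card (A <+> B)) =
     subgraph_weight (free_comps k W w B) (card B) *
     subgraph_weight (num_comps (add_edges G u (?S B)) (A <+> ?S B)) (card A)"
    if "A \<in> Pow (edges G)" "B \<in> Pow (edges W)" for A B
  proof -
    have "card (A <+> B) = card A + card B"
      using that assms(1,2) by (intro card_Plus) (auto simp: multigraph_def intro: finite_subset)
    then show ?thesis
      using num_comps_glue[OF assms, of A B] that
      by (simp add: subgraph_weight_def power_add algebra_simps)
  qed
  moreover have "edges (glue k G u W w) = edges G <+> edges W" by (simp add: glue_def)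
  ultimately show ?thesis
    unfolding subgraph_sum_def subgraph_sum_with_def sum_distrib_left by (simp add: sum_Pow_Plus)
qed

section \<open>Normalising factors and comparison of \<open>G\<close> with \<open>H\<close>\<close>

lemma num_comps_add_edges_connected:
  assumes "connected_graph G"
  shows "num_comps (add_edges G u S) (edges G <+> S') = 1"
proof -
  let ?GS = "(add_edges G u S)\<lparr>edges := edges G <+> S'\<rparr>"
  have "joined ?GS x y" if "x \<in> verts G" "y \<in> verts G" for x y
  proof -
    have "joined G x y" using assms that by (simp add: connected_graph_def)
    then have "joined ?GS (id x) (id y)"
    proof (rule joined_image)
      fix a b assume "adjacent G a b"
      then obtain e where "e \<in> edges G" "ends G e = {a, b}" by (auto simp: adjacent_def)
      then have "adjacent ?GS a b"
        unfolding adjacent_def add_edges_def by (intro bexI[of _ "Inl e"]) auto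
      then show "joined ?GS (id a) (id b)" by (simp add: adjacent_imp_joined)
    qed
    then show ?thesis by simp
  qed
  moreover obtain r where "r \<in> verts G" using assms by (auto simp: connected_graph_def)
  ultimately have "component_of ?GS ` verts G = (\<lambda>_. component_of ?GS r) ` verts G"
    by (intro image_cong refl) (simp add: component_of_eq_iff)
  also have "\<dots> = {component_of ?GS r}" using \<open>r \<in> verts G\<close> by auto
  finally have "component_of ?GS ` verts G = {component_of ?GS r}" .
  then show ?thesis by (simp add: num_comps_eq add_edges_def)
qed

text \<open>Connectedness of \<open>G\<close> leaves \<open>card (verts G)\<close> as the only
  quantity from \<open>G\<close> in the prefactor.\<close>

lemma tutte_glue:
  assumes "multigraph G" "connected_graph G" "multigraph W" "verts W \<inter> verts G = {}"
    and "u ` {1..k} \<subseteq> verts G" "w ` {1..k} \<subseteq> verts W" "inj_on w {1..k}"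
  shows "(var_x - 1) ^ (1 + free_comps k W w (edges W)) *
     (var_y - 1) ^ (card (verts G) + free_comps k W w {}) * tutte (glue k G u W w) =
     subgraph_sum (glue k G u W w)"
proof -
  note nc = num_comps_glue[OF assms(1,3-6)]
  have "num_comps (glue k G u W w) (edges (glue k G u W w)) = 1 + free_comps k W w (edges W)"
    using nc[of "edges G" "edges W"] num_comps_add_edges_connected[OF assms(2)]
    by (simp add: glue_def)
  moreover have "card (verts (glue k G u W w)) = card (verts G) + free_comps k W w {}"
    using nc[of "{}" "{}"] linked_pairs_no_edges[OF assms(7), of W]
      num_comps_no_edges[of "glue k G u W w"] num_comps_no_edges[of "add_edges G u {}"]
    by (simp add: Plus_def) (simp add: add_edges_def)
  ultimately show ?thesis
    using tutte_subgraph_sum[OF multigraph_glue[OF assms(1,3)], of k u w] by simp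
qed

text \<open>The triangular system of \<open>subgraph_sum_add_edges\<close> is solved by induction on
  \<open>S\<close>. The crossed powers of \<open>y - 1\<close> balance the vertex counts in the
  normalising factors of \<open>G\<close> and \<open>H\<close>.\<close>

lemma subgraph_sum_with_eq:
  assumes G: "multigraph G" "connected_graph G" "u ` {1..k} \<subseteq> verts G"
    and H: "multigraph H" "connected_graph H" "v ` {1..k} \<subseteq> verts H"
    and T: "\<And>S. S \<subseteq> index_pairs k \<Longrightarrow> T_equivalent (add_edges G u S) (add_edges H v S)"
    and S: "S \<subseteq> index_pairs k"
  shows "(var_y - 1) ^ card (verts H) * subgraph_sum_with G u S =
         (var_y - 1) ^ card (verts G) * subgraph_sum_with H v S"
proof -
  let ?Q = "var_y - 1" and ?n = "card (verts G)" and ?m = "card (verts H)"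
  have "finite S" using S finite_index_pairs finite_subset by blast
  then show ?thesis using S
  proof (induction S rule: finite_psubset_induct)
    case (psubset S)
    have fin: "finite (edges G)" "finite (edges H)" using G(1) H(1) by (auto simp: multigraph_def)
    have ZG: "(var_x - 1) * ?Q ^ ?n * tutte (add_edges G u S) = subgraph_sum (add_edges G u S)"
      using tutte_subgraph_sum[OF multigraph_add_edges[OF G(1,3) psubset.prems]]
        num_comps_add_edges_connected[OF G(2), of u S S] by (simp add: add_edges_def)
    have ZH: "(var_x - 1) * ?Q ^ ?m * tutte (add_edges H v S) = subgraph_sum (add_edges H v S)"
      using tutte_subgraph_sum[OF multigraph_add_edges[OF H(1,3) psubset.prems]]
        num_comps_add_edges_connected[OF H(2), of v S S] by (simp add: add_edges_def)
    have "tutte (add_edges G u S) = tutte (add_edges H v S)"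
      using T[OF psubset.prems] by (simp add: T_equivalent_def)
    then have "?Q ^ ?m * subgraph_sum (add_edges G u S) = ?Q ^ ?n * subgraph_sum (add_edges H v S)"
      unfolding ZG[symmetric] ZH[symmetric] by (simp only: mult_ac)
    then have "(\<Sum>S' \<in> Pow S. ?Q ^ card S' * (?Q ^ ?m * subgraph_sum_with G u S')) =
        (\<Sum>S' \<in> Pow S. ?Q ^ card S' * (?Q ^ ?n * subgraph_sum_with H v S'))"
      by (simp add: subgraph_sum_add_edges fin psubset.hyps sum_distrib_left mult.left_commute)
    \<comment> \<open>Proper subsets agree term by term by the induction hypothesis; subtracting
      them isolates the term of \<open>S\<close> itself.\<close>
    moreover have "(\<Sum>S' \<in> Pow S - {S}. ?Q ^ card S' * (?Q ^ ?m * subgraph_sum_with G u S')) =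
        (\<Sum>S' \<in> Pow S - {S}. ?Q ^ card S' * (?Q ^ ?n * subgraph_sum_with H v S'))"
      using psubset by (intro sum.cong refl) (auto simp: psubset_eq)
    ultimately have "?Q ^ card S * (?Q ^ ?m * subgraph_sum_with G u S) =
        ?Q ^ card S * (?Q ^ ?n * subgraph_sum_with H v S)"
      using psubset.hyps by (simp add: sum.remove[of "Pow S" S])
    then show ?case using var_y_minus_1_nonzero by simp
  qed
qed

theorem theorem3p1:
  fixes G :: "('v, 'e) mgraph" and H :: "('v, 'f) mgraph" and W :: "('v, 'g) mgraph"
    and u v w :: "nat \<Rightarrow> 'v" and k :: nat
  assumes "multigraph G" and "connected_graph G"
    and "multigraph H" and "connected_graph H"
    and "verts G \<inter> verts H = {}"
    and "u ` {1..k} \<subseteq> verts G" and "inj_on u {1..k}"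
    and "v ` {1..k} \<subseteq> verts H" and "inj_on v {1..k}"
    and "\<And>S. S \<subseteq> index_pairs k \<Longrightarrow> T_equivalent (add_edges G u S) (add_edges H v S)"
    and "multigraph W"
    and "verts W \<inter> verts G = {}" and "verts W \<inter> verts H = {}"
    and "w ` {1..k} \<subseteq> verts W" and "inj_on w {1..k}"
  shows "T_equivalent (glue k G u W w) (glue k H v W w)"
proof -
  let ?P = "var_x - 1" and ?Q = "var_y - 1" and ?n = "card (verts G)" and ?m = "card (verts H)"
  let ?c = "1 + free_comps k W w (edges W)" and ?d = "free_comps k W w {}"
  note TG = tutte_glue[OF assms(1,2,11,12,6,14,15)] and TH = tutte_glue[OF assms(3,4,11,13,8,14,15)]
  have "?Q ^ ?m * subgraph_sum (glue k G u W w) = ?Q ^ ?n * subgraph_sum (glue k H v W w)"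
    unfolding subgraph_sum_glue[OF assms(1,11,12,6,14)] subgraph_sum_glue[OF assms(3,11,13,8,14)]
      sum_distrib_left
  proof (intro sum.cong refl)
    \<comment> \<open>Both sides have the same coefficient from \<open>W\<close> and the same index
      set \<open>linked_pairs k W w B\<close>.\<close>
    fix B
    show "?Q ^ ?m * (subgraph_weight (free_comps k W w B) (card B) *
            subgraph_sum_with G u (linked_pairs k W w B)) =
          ?Q ^ ?n * (subgraph_weight (free_comps k W w B) (card B) *
            subgraph_sum_with H v (linked_pairs k W w B))"
      using subgraph_sum_with_eq[OF assms(1,2,6,3,4,8,10) linked_pairs_subset[of k W w B]]
      by (simp add: mult.left_commute)
  qed
  \<comment> \<open>The prefactors contain \<open>?n + ?d\<close> for \<open>G\<close> and
    \<open>?m + ?d\<close> for \<open>H\<close>; the crossed powers make them one common factor,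
    which is nonzero and cancels in the integral domain of polynomials.\<close>
  then have "(?P ^ ?c * ?Q ^ (?n + ?m + ?d)) * tutte (glue k G u W w) =
      (?P ^ ?c * ?Q ^ (?n + ?m + ?d)) * tutte (glue k H v W w)"
    unfolding TG[symmetric] TH[symmetric] by (simp add: power_add algebra_simps)
  then show ?thesis
    using var_x_minus_1_nonzero var_y_minus_1_nonzero by (simp add: T_equivalent_def)
qed

end
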